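(* Let $(S,\to,\twoheadrightarrow,\hookrightarrow)$ be a finite two-acyclic factorization system. Then $\operatorname{Pairs}(\to)$ is extremal if and only if $\to$ is an acyclic reflexive relation.
   Context: A finite lattice $L$ is extremal if it has a chain $x_0<x_1<\cdots<x_N$ of length $N$, where $|\operatorname{Ji}L|=|\operatorname{Mi}L|=N$; here $\operatorname{Ji}L$ (resp. $\operatorname{Mi}L$) is the set of join-irreducible elements (covering exactly one element) (resp. meet-irreducible elements (covered by exactly one element)). An acyclic reflexive relation is a reflexive relation that, when interpreted as a directed graph, is acyclic except for 1-cycles. For a binary relation $\to$ on a set $S$ and $X\subseteq S$, put $X^\perp=\{y\in S: x\not\to y\ \forall x\in X\}$ and ${}^\perp X=\{y\in S: y\not\to x\ \forall x\in X\}$. A maximal orthogonal pair is a pair $(X,Y)$ of subsets of $S$ with $Y=X^\perp$ and $X={}^\perp Y$. $\operatorname{Pairs}(\to)$ is the complete lattice of maximal orthogonal pairs, partially ordered by containment of first components. For a reflexive relation $\to$ on $S$, $\operatorname{Fact}(\to)=(\twoheadrightarrow,\hookrightarrow)$, where $x\twoheadrightarrow y$ iff for all $z$, $y\to z$ implies $x\to z$, and $x\hookrightarrow y$ iff for all $z$, $z\to x$ implies $z\to y$. For preorders $\twoheadrightarrow,\hookrightarrow$ on $S$, $\operatorname{Mult}(\twoheadrightarrow,\hookrightarrow)$ is the relation relating $x$ to $z$ iff there is $y\in S$ with $x\twoheadrightarrow y\hookrightarrow z$. A factorization system is a tuple $(S,\to,\twoheadrightarrow,\hookrightarrow)$ with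 $\to$ reflexive, $\operatorname{Fact}(\to)=(\twoheadrightarrow,\hookrightarrow)$ and $\operatorname{Mult}(\twoheadrightarrow,\hookrightarrow)=\to$; it is finite if $S$ is finite. It is two-acyclic if $x\twoheadrightarrow y\twoheadrightarrow x$ implies $x=y$, $x\hookrightarrow y\hookrightarrow x$ implies $x=y$, and $x\twoheadrightarrow y\hookrightarrow x$ implies $x=y$. *)

theory Defs
  imports "HOL-Algebra.Complete_Lattice"
begin

section \<open>Extremal lattices\<close>

definition covers :: "('a, 'b) gorder_scheme \<Rightarrow> 'a \<Rightarrow> 'a \<Rightarrow> bool" where
  "covers L x y \<longleftrightarrow> x \<in> carrier L \<and> y \<in> carrier L \<and> y \<sqsubset>\<^bsub>L\<^esub> x \<and>
     \<not> (\<exists>z\<in>carrier L. y \<sqsubset>\<^bsub>L\<^esub> z \<and> z \<sqsubset>\<^bsub>L\<^esub> x)"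

definition Ji :: "('a, 'b) gorder_scheme \<Rightarrow> 'a set" where
  "Ji L = {x \<in> carrier L. \<exists>!y. covers L x y}"

definition Mi :: "('a, 'b) gorder_scheme \<Rightarrow> 'a set" where
  "Mi L = {x \<in> carrier L. \<exists>!y. covers L y x}"

definition has_chain_of_length :: "('a, 'b) gorder_scheme \<Rightarrow> nat \<Rightarrow> bool" where
  "has_chain_of_length L N \<longleftrightarrow>
     (\<exists>x :: nat \<Rightarrow> 'a. (\<forall>i\<le>N. x i \<in> carrier L) \<and> (\<forall>i<N. x i \<sqsubset>\<^bsub>L\<^esub> x (Suc i)))"

definition extremal :: "('a, 'b) gorder_scheme \<Rightarrow> bool" where
  "extremal L \<longleftrightarrow> lattice L \<and> finite (carrier L) \<and>
     (\<exists>N. card (Ji L) = N \<and> card (Mi L) = N \<and> has_chain_of_length L N)"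

section \<open>Maximal orthogonal pairs\<close>

definition right_perp :: "'a set \<Rightarrow> 'a rel \<Rightarrow> 'a set \<Rightarrow> 'a set" where
  "right_perp S r X = {y \<in> S. \<forall>x\<in>X. (x, y) \<notin> r}"

definition left_perp :: "'a set \<Rightarrow> 'a rel \<Rightarrow> 'a set \<Rightarrow> 'a set" where
  "left_perp S r X = {y \<in> S. \<forall>x\<in>X. (y, x) \<notin> r}"

definition Pairs :: "'a set \<Rightarrow> 'a rel \<Rightarrow> ('a set \<times> 'a set) gorder" where
  "Pairs S r =
     \<lparr> carrier = {(X, Y). X \<subseteq> S \<and> Y \<subseteq> S \<and> Y = right_perp S r X \<and> X = left_perp S r Y},
       eq = (=),
       le = (\<lambda>P Q. fst P \<subseteq> fst Q) \<rparr>"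

lemma Pairs_complete_lattice: "complete_lattice (Pairs S r)"
proof -
  interpret po: partial_order "Pairs S r"
    by unfold_locales (auto simp: Pairs_def)
  have le: "P \<sqsubseteq>\<^bsub>Pairs S r\<^esub> Q \<longleftrightarrow> fst P \<subseteq> fst Q" for P Q
    by (simp add: Pairs_def)
  have fst_eq: "fst P = left_perp S r (snd P)" and snd_eq: "snd P = right_perp S r (fst P)"
    if "P \<in> carrier (Pairs S r)" for P
    using that by (auto simp: Pairs_def)
  have closed_left: "(left_perp S r Z, right_perp S r (left_perp S r Z)) \<in> carrier (Pairs S r)"
    if "Z \<subseteq> S" for Z
    using that unfolding Pairs_def left_perp_def right_perp_def by auto
  have closed_right: "(left_perp S r (right_perp S r Z), right_perp S r Z) \<in> carrier (Pairs S r)"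
    if "Z \<subseteq> S" for Z
    using that unfolding Pairs_def left_perp_def right_perp_def by auto
  have anti_left: "left_perp S r V \<subseteq> left_perp S r U" if "U \<subseteq> V" for U V
    using that unfolding left_perp_def by blast
  have adj: "U \<subseteq> left_perp S r V \<longleftrightarrow> V \<subseteq> right_perp S r U" if "U \<subseteq> S" "V \<subseteq> S" for U V
    using that unfolding left_perp_def right_perp_def by blast
  have sub: "fst P \<subseteq> S" "snd P \<subseteq> S" if "P \<in> carrier (Pairs S r)" for P
    using that by (auto simp: Pairs_def)
  have inf_ex: "\<exists>i. greatest (Pairs S r) i (Lower (Pairs S r) A)"
    if A: "A \<subseteq> carrier (Pairs S r)" for A
  proof -
    let ?Z = "\<Union>(snd ` A)"
    let ?i = "(left_perp S r ?Z, right_perp S r (left_perp S r ?Z))"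
    have Z: "?Z \<subseteq> S" using A sub(2) by blast
    have iff: "X \<subseteq> left_perp S r ?Z \<longleftrightarrow> (\<forall>P\<in>A. X \<subseteq> fst P)" if "X \<subseteq> S" for X
    proof -
      have "X \<subseteq> left_perp S r ?Z \<longleftrightarrow> (\<forall>P\<in>A. X \<subseteq> left_perp S r (snd P))"
        using that unfolding left_perp_def by blast
      then show ?thesis using A fst_eq by (metis subsetD)
    qed
    have low: "\<forall>P\<in>A. left_perp S r ?Z \<subseteq> fst P"
      using iff[of "left_perp S r ?Z"] unfolding left_perp_def by blast
    have "greatest (Pairs S r) ?i (Lower (Pairs S r) A)"
    proof (rule greatest_LowerI)
      show "?i \<sqsubseteq>\<^bsub>Pairs S r\<^esub> P" if "P \<in> A" for P
        using low that by (simp add: le)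
      show "Q \<sqsubseteq>\<^bsub>Pairs S r\<^esub> ?i" if Q: "Q \<in> Lower (Pairs S r) A" for Q
      proof -
        have "Q \<in> carrier (Pairs S r)" "\<forall>P\<in>A. fst Q \<subseteq> fst P"
          using Q A unfolding Lower_def le by blast+
        then show ?thesis using iff[of "fst Q"] sub(1) by (simp add: le)
      qed
    qed (use A closed_left[OF Z] in auto)
    then show ?thesis by blast
  qed
  have sup_ex: "\<exists>s. least (Pairs S r) s (Upper (Pairs S r) A)"
    if A: "A \<subseteq> carrier (Pairs S r)" for A
  proof -
    let ?Z = "\<Union>(fst ` A)"
    let ?s = "(left_perp S r (right_perp S r ?Z), right_perp S r ?Z)"
    have Z: "?Z \<subseteq> S" using A sub(1) by blast
    have Y: "right_perp S r ?Z \<subseteq> S" unfolding right_perp_def by blast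
    have "least (Pairs S r) ?s (Upper (Pairs S r) A)"
    proof (rule least_UpperI)
      show "P \<sqsubseteq>\<^bsub>Pairs S r\<^esub> ?s" if "P \<in> A" for P
      proof -
        have "?Z \<subseteq> left_perp S r (right_perp S r ?Z)" using adj[OF Z Y] by simp
        moreover have "fst P \<subseteq> ?Z" using that by blast
        ultimately show ?thesis by (simp add: le)
      qed
      show "?s \<sqsubseteq>\<^bsub>Pairs S r\<^esub> Q" if Q: "Q \<in> Upper (Pairs S r) A" for Q
      proof -
        have Qc: "Q \<in> carrier (Pairs S r)" and "?Z \<subseteq> fst Q"
          using Q A unfolding Upper_def le by blast+
        then have "?Z \<subseteq> left_perp S r (snd Q)" using fst_eq by metis
        then have "snd Q \<subseteq> right_perp S r ?Z" using adj[OF Z sub(2)[OF Qc]] by simp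
        then have "left_perp S r (right_perp S r ?Z) \<subseteq> left_perp S r (snd Q)"
          by (rule anti_left)
        then show ?thesis using fst_eq[OF Qc] by (simp add: le)
      qed
    qed (use A closed_right[OF Z] in auto)
    then show ?thesis by blast
  qed
  show ?thesis
    by unfold_locales (use inf_ex sup_ex in auto)
qed

section \<open>Factorization systems\<close>

definition Fact :: "'a set \<Rightarrow> 'a rel \<Rightarrow> 'a rel \<times> 'a rel" where
  "Fact S r =
     ({(x, y). x \<in> S \<and> y \<in> S \<and> (\<forall>z\<in>S. (y, z) \<in> r \<longrightarrow> (x, z) \<in> r)},
      {(x, y). x \<in> S \<and> y \<in> S \<and> (\<forall>z\<in>S. (z, x) \<in> r \<longrightarrow> (z, y) \<in> r)})"

lemma preorder_on_Fact: "preorder_on S (fst (Fact S r))" "preorder_on S (snd (Fact S r))"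
  by (auto simp: Fact_def preorder_on_def refl_on_def trans_def)

definition Mult :: "'a set \<Rightarrow> 'a rel \<Rightarrow> 'a rel \<Rightarrow> 'a rel" where
  "Mult S e m = {(x, z). x \<in> S \<and> z \<in> S \<and> (\<exists>y\<in>S. (x, y) \<in> e \<and> (y, z) \<in> m)}"

text \<open>Throughout, \<open>r\<close> is the relation \<open>\<rightarrow>\<close>, \<open>e\<close> the two-headed arrow (``onto'') and \<open>m\<close> the
  hooked arrow (``into''). Since \<^const>\<open>refl_on\<close> does not confine a relation to its carrier,
  \<open>r \<subseteq> S \<times> S\<close> is required separately.\<close>

locale factorization_system =
  fixes S :: "'a set" and r e m :: "'a rel"
  assumes rel_on: "r \<subseteq> S \<times> S"
    and refl: "refl_on S r"
    and Fact_eq: "Fact S r = (e, m)"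
    and Mult_eq: "Mult S e m = r"

locale finite_factorization_system = factorization_system +
  assumes finite_carrier: "finite S"

definition two_acyclic :: "'a rel \<Rightarrow> 'a rel \<Rightarrow> bool" where
  "two_acyclic e m \<longleftrightarrow>
     (\<forall>x y. (x, y) \<in> e \<and> (y, x) \<in> e \<longrightarrow> x = y) \<and>
     (\<forall>x y. (x, y) \<in> m \<and> (y, x) \<in> m \<longrightarrow> x = y) \<and>
     (\<forall>x y. (x, y) \<in> e \<and> (y, x) \<in> m \<longrightarrow> x = y)"

definition acyclic_reflexive :: "'a set \<Rightarrow> 'a rel \<Rightarrow> bool" where
  "acyclic_reflexive S r \<longleftrightarrow> r \<subseteq> S \<times> S \<and> refl_on S r \<and> acyclic (r - Id)"

end

theory Submission
  imports Defs
begin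

text \<open>For a two-acyclic factorization system, \<open>x\<close> corresponds to the closed set
  \<open>{y. x \<twoheadrightarrow> y}\<close>, which stays closed after removing \<open>x\<close>; so these sets are the
  join-irreducibles and, dually, \<open>|Ji| = |Mi| = |S|\<close>. If \<open>\<rightarrow>\<close> is acyclic, every up-set is closed
  and a linear extension gives a chain of length \<open>|S|\<close>. Conversely, in a chain of pairs
  \<open>(X\<^sub>i, Y\<^sub>i)\<close> of length \<open>|S|\<close> counting forces \<open>|X\<^sub>i| = i\<close> and \<open>|Y\<^sub>i| = |S| - i\<close>, while reflexivity
  makes them disjoint; so \<open>Y\<^sub>i = S - X\<^sub>i\<close>, each \<open>X\<^sub>i\<close> is an up-set, and the chain linearly orders
  \<open>S\<close> compatibly with \<open>\<rightarrow>\<close>.\<close>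

section \<open>The order on maximal orthogonal pairs\<close>

lemma Pairs_le [simp]: "P \<sqsubseteq>\<^bsub>Pairs S r\<^esub> Q \<longleftrightarrow> fst P \<subseteq> fst Q"
  by (simp add: Pairs_def)

lemma carrier_Pairs_iff:
  "P \<in> carrier (Pairs S r) \<longleftrightarrow>
     snd P = right_perp S r (fst P) \<and> fst P = left_perp S r (snd P)"
proof -
  have "left_perp S r A \<subseteq> S" "right_perp S r A \<subseteq> S" for A
    unfolding left_perp_def right_perp_def by blast+
  then show ?thesis unfolding Pairs_def by (cases P) (simp, metis)
qed

lemma Pairs_orthogonal:
  "P \<in> carrier (Pairs S r) \<Longrightarrow> x \<in> fst P \<Longrightarrow> y \<in> snd P \<Longrightarrow> (x, y) \<notin> r"
  by (drule carrier_Pairs_iff[THEN iffD1, THEN conjunct1]) (simp add: right_perp_def)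

lemma carrier_Pairs_eqI:
  "P \<in> carrier (Pairs S r) \<Longrightarrow> Q \<in> carrier (Pairs S r) \<Longrightarrow> fst P = fst Q \<Longrightarrow> P = Q"
  by (metis carrier_Pairs_iff prod_eqI)

lemma right_perp_antimono: "A \<subseteq> B \<Longrightarrow> right_perp S r B \<subseteq> right_perp S r A"
  unfolding right_perp_def by blast

lemma left_perp_antimono: "A \<subseteq> B \<Longrightarrow> left_perp S r B \<subseteq> left_perp S r A"
  unfolding left_perp_def by blast

lemma Pairs_less:
  assumes "P \<in> carrier (Pairs S r)" "Q \<in> carrier (Pairs S r)"
  shows "P \<sqsubset>\<^bsub>Pairs S r\<^esub> Q \<longleftrightarrow> fst P \<subset> fst Q"
proof -
  have "eq (Pairs S r) = (=)" by (simp add: Pairs_def)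
  then show ?thesis
    using carrier_Pairs_eqI[OF assms] by (auto simp: lless_def)
qed

lemma fst_carrier_Pairs: "P \<in> carrier (Pairs S r) \<Longrightarrow> fst P \<subseteq> S"
  by (auto simp: Pairs_def)

lemma snd_carrier_Pairs: "P \<in> carrier (Pairs S r) \<Longrightarrow> snd P \<subseteq> S"
  by (auto simp: Pairs_def)

lemma left_perp_in_Pairs:
  "Z \<subseteq> S \<Longrightarrow> (left_perp S r Z, right_perp S r (left_perp S r Z)) \<in> carrier (Pairs S r)"
  unfolding carrier_Pairs_iff left_perp_def right_perp_def by auto

lemma finite_carrier_Pairs:
  assumes "finite S"
  shows "finite (carrier (Pairs S r))"
  by (rule finite_subset[of _ "Pow S \<times> Pow S"])
    (use assms in \<open>auto simp: Pairs_def\<close>)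

lemma Pairs_snd_antimono:
  assumes "P \<in> carrier (Pairs S r)" "Q \<in> carrier (Pairs S r)"
  shows "fst P \<subset> fst Q \<longleftrightarrow> snd Q \<subset> snd P"
proof -
  have "fst P \<subseteq> fst Q \<longleftrightarrow> snd Q \<subseteq> snd P"
    and "fst Q \<subseteq> fst P \<longleftrightarrow> snd P \<subseteq> snd Q"
    using assms right_perp_antimono left_perp_antimono by (metis carrier_Pairs_iff)+
  then show ?thesis by blast
qed

lemma covers_Pairs_iff:
  "covers (Pairs S r) P Q \<longleftrightarrow> P \<in> carrier (Pairs S r) \<and> Q \<in> carrier (Pairs S r) \<and>
     fst Q \<subset> fst P \<and> \<not> (\<exists>R\<in>carrier (Pairs S r). fst Q \<subset> fst R \<and> fst R \<subset> fst P)"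
  by (simp add: covers_def Pairs_less cong: conj_cong bex_cong ball_cong)

text \<open>By finiteness, a maximal first component among those containing \<open>fst P\<close> and
  strictly inside \<open>fst Q\<close> belongs to a lower cover of \<open>Q\<close>.\<close>

lemma lower_cover_above:
  assumes "finite S" and P: "P \<in> carrier (Pairs S r)" and Q: "Q \<in> carrier (Pairs S r)"
    and less: "fst P \<subset> fst Q"
  obtains R where "covers (Pairs S r) Q R" "fst P \<subseteq> fst R"
proof -
  let ?A = "fst ` {R \<in> carrier (Pairs S r). fst R \<subset> fst Q}"
  have "finite ?A" using finite_carrier_Pairs[OF \<open>finite S\<close>] by simp
  moreover have "fst P \<in> ?A" using P less by blast
  ultimately obtain X where X: "X \<in> ?A" "fst P \<subseteq> X" "\<forall>Y\<in>?A. X \<subseteq> Y \<longrightarrow> X = Y"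
    using finite_has_maximal2 by meson
  then obtain R where "R \<in> carrier (Pairs S r)" "fst R \<subset> fst Q" "X = fst R" by blast
  have "\<not> (fst R \<subset> fst T \<and> fst T \<subset> fst Q)" if "T \<in> carrier (Pairs S r)" for T
  proof
    assume T: "fst R \<subset> fst T \<and> fst T \<subset> fst Q"
    with that have "fst T \<in> ?A" by (intro imageI CollectI) auto
    with X(3) \<open>X = fst R\<close> have "fst R \<subseteq> fst T \<longrightarrow> fst R = fst T" by (metis (no_types))
    with T show False by (simp add: psubset_eq)
  qed
  with Q \<open>R \<in> carrier (Pairs S r)\<close> \<open>fst R \<subset> fst Q\<close> have "covers (Pairs S r) Q R"
    by (simp add: covers_Pairs_iff)
  with that X(2) \<open>X = fst R\<close> show ?thesis by simp
qed

section \<open>Irreducible elements\<close>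

text \<open>Packaged as a locale so that it can be interpreted again at the converse relation for
  the dual results.\<close>

locale finite_two_acyclic_factorization_system = finite_factorization_system +
  assumes two_acyclic: "two_acyclic e m"
begin

lemma e_iff: "(x, y) \<in> e \<longleftrightarrow> x \<in> S \<and> y \<in> S \<and> (\<forall>z\<in>S. (y, z) \<in> r \<longrightarrow> (x, z) \<in> r)"
proof -
  have "e = fst (Fact S r)" by (simp only: Fact_eq fst_conv)
  then show ?thesis by (simp only: Fact_def fst_conv) simp
qed

lemma m_iff: "(x, y) \<in> m \<longleftrightarrow> x \<in> S \<and> y \<in> S \<and> (\<forall>z\<in>S. (z, x) \<in> r \<longrightarrow> (z, y) \<in> r)"
proof -
  have "m = snd (Fact S r)" by (simp only: Fact_eq snd_conv)
  then show ?thesis by (simp only: Fact_def snd_conv) simp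
qed

lemma r_iff: "(x, z) \<in> r \<longleftrightarrow> (\<exists>y. (x, y) \<in> e \<and> (y, z) \<in> m)"
proof -
  have "(x, z) \<in> r \<longleftrightarrow> (x, z) \<in> Mult S e m" by (simp only: Mult_eq)
  also have "\<dots> \<longleftrightarrow> (\<exists>y. (x, y) \<in> e \<and> (y, z) \<in> m)"
    unfolding Mult_def by (auto dest: e_iff[THEN iffD1] m_iff[THEN iffD1])
  finally show ?thesis .
qed

lemma e_trans: "(x, y) \<in> e \<Longrightarrow> (y, z) \<in> e \<Longrightarrow> (x, z) \<in> e"
  unfolding e_iff by blast

lemma e_antisym: "(x, y) \<in> e \<Longrightarrow> (y, x) \<in> e \<Longrightarrow> x = y"
  using two_acyclic unfolding two_acyclic_def by blast

lemma e_m_trivial: "(x, y) \<in> e \<Longrightarrow> (y, x) \<in> m \<Longrightarrow> x = y"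
  using two_acyclic unfolding two_acyclic_def by blast

text \<open>The Galois closure of \<open>{x}\<close>: for \<open>x\<close> in \<open>S\<close>, the
  least pair whose first component contains \<open>x\<close>.\<close>

definition principal :: "'a \<Rightarrow> 'a set \<times> 'a set" where
  "principal x =
     (left_perp S r (right_perp S r {x}), right_perp S r (left_perp S r (right_perp S r {x})))"

text \<open>Contraposing the double perp: \<open>y\<close> belongs to it iff
  \<open>(y, z) \<in> r\<close> always implies \<open>(x, z) \<in> r\<close>, which is how
  \<open>Fact\<close> defines \<open>e\<close>.\<close>

lemma fst_principal: "x \<in> S \<Longrightarrow> fst (principal x) = {y. (x, y) \<in> e}"
  unfolding principal_def e_iff left_perp_def right_perp_def by auto

lemma principal_in_Pairs: "principal x \<in> carrier (Pairs S r)"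
  unfolding principal_def by (rule left_perp_in_Pairs) (auto simp: right_perp_def)

lemma principal_self: "x \<in> S \<Longrightarrow> x \<in> fst (principal x)"
  unfolding principal_def left_perp_def right_perp_def by auto

lemma principal_least:
  assumes "P \<in> carrier (Pairs S r)" "x \<in> fst P"
  shows "fst (principal x) \<subseteq> fst P"
proof -
  have "{x} \<subseteq> fst P" using assms(2) by simp
  then have "left_perp S r (right_perp S r {x}) \<subseteq> left_perp S r (right_perp S r (fst P))"
    by (intro left_perp_antimono right_perp_antimono)
  also have "\<dots> = fst P" using assms(1) by (metis carrier_Pairs_iff)
  finally show ?thesis by (simp add: principal_def)
qed

lemma inj_on_principal: "inj_on principal S"
proof (rule inj_onI)
  fix x y assume xy: "x \<in> S" "y \<in> S" "principal x = principal y"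
  then have "y \<in> fst (principal x)" "x \<in> fst (principal y)"
    using principal_self[of x] principal_self[of y] by simp_all
  then have "(x, y) \<in> e" "(y, x) \<in> e"
    unfolding fst_principal[OF xy(1)] fst_principal[OF xy(2)] by simp_all
  then show "x = y" by (rule e_antisym)
qed

text \<open>Enlarging the second set by \<open>x\<close> deletes from the closure exactly the points
  with an arrow to \<open>x\<close>. Reflexivity makes \<open>x\<close> one of them; factorization
  and two-acyclicity exclude all others.\<close>

lemma principal_minus_self_closed:
  assumes "x \<in> S"
  shows "\<exists>P\<in>carrier (Pairs S r). fst P = fst (principal x) - {x}"
proof -
  let ?Z = "insert x (right_perp S r {x})"
  have "left_perp S r ?Z = fst (principal x) - {x}"
  proof -
    have "(y, x) \<notin> r" if "(x, y) \<in> e" "y \<noteq> x" for y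
    proof
      assume "(y, x) \<in> r"
      \<comment> \<open>Composing \<open>e\<close> from \<open>x\<close> through \<open>y\<close> to
        \<open>w\<close>, the mixed clause of two-acyclicity forces \<open>w = x\<close>;
        antisymmetry of \<open>e\<close> then forces \<open>y = x\<close>.\<close>
      then obtain w where w: "(y, w) \<in> e" "(w, x) \<in> m"
        unfolding r_iff by blast
      from that(1) w(1) have "(x, w) \<in> e" by (rule e_trans)
      then have "x = w" using w(2) by (rule e_m_trivial)
      then show False using e_antisym[OF that(1)] w(1) that(2) by simp
    qed
    moreover have "left_perp S r ?Z = fst (principal x) \<inter> {y. (y, x) \<notin> r}"
      unfolding principal_def left_perp_def by auto
    moreover have "(x, x) \<in> r" using refl assms by (rule refl_onD)
    ultimately show ?thesis using fst_principal[OF assms] by auto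
  qed
  moreover have "?Z \<subseteq> S" using assms by (auto simp: right_perp_def)
  ultimately show ?thesis using left_perp_in_Pairs[of ?Z S r] by (metis fst_conv)
qed

lemma Ji_Pairs: "Ji (Pairs S r) = principal ` S"
proof
  show "principal ` S \<subseteq> Ji (Pairs S r)"
  proof
    fix Q assume "Q \<in> principal ` S"
    then obtain x where x: "x \<in> S" "Q = principal x" by blast
    obtain P where P: "P \<in> carrier (Pairs S r)" "fst P = fst (principal x) - {x}"
      using principal_minus_self_closed[OF x(1)] by blast
    \<comment> \<open>A pair strictly below \<open>principal x\<close> cannot contain
      \<open>x\<close>, as it would then contain the whole closure; so \<open>P\<close> dominates
      every such pair.\<close>
    have below: "fst R \<subseteq> fst P"
      if "R \<in> carrier (Pairs S r)" "fst R \<subset> fst (principal x)" for R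
      using that principal_least[of R x] P(2) by blast
    have "covers (Pairs S r) (principal x) P"
    proof -
      have "fst P \<subset> fst (principal x)" using P(2) principal_self[OF x(1)] by blast
      moreover have "\<not> (fst P \<subset> fst R \<and> fst R \<subset> fst (principal x))"
        if "R \<in> carrier (Pairs S r)" for R
        using below[OF that] by blast
      ultimately show ?thesis using P(1) principal_in_Pairs by (simp add: covers_Pairs_iff)
    qed
    moreover have "R = P" if "covers (Pairs S r) (principal x) R" for R
    proof -
      from that have R: "R \<in> carrier (Pairs S r)" "fst R \<subset> fst (principal x)"
        and max: "\<not> (fst R \<subset> fst P \<and> fst P \<subset> fst (principal x))"
        using P(1) by (simp_all add: covers_Pairs_iff)
      have "fst P \<subset> fst (principal x)" using P(2) principal_self[OF x(1)] by blast
      with max below[OF R] have "fst R = fst P" by (simp add: psubset_eq)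
      with R(1) P(1) show ?thesis by (rule carrier_Pairs_eqI)
    qed
    ultimately have "\<exists>!R. covers (Pairs S r) (principal x) R" by (rule ex1I)
    then show "Q \<in> Ji (Pairs S r)"
      unfolding Ji_def x(2) using principal_in_Pairs by simp
  qed
  show "Ji (Pairs S r) \<subseteq> principal ` S"
  proof
    fix Q assume "Q \<in> Ji (Pairs S r)"
    then obtain R where Q: "Q \<in> carrier (Pairs S r)" and R: "covers (Pairs S r) Q R"
      and uniq: "\<And>R'. covers (Pairs S r) Q R' \<Longrightarrow> R' = R"
      unfolding Ji_def by blast
    \<comment> \<open>Any point of \<open>Q\<close> lost in its unique lower cover generates
      \<open>Q\<close>: a smaller closure would lie below some lower cover, hence inside
      \<open>R\<close>, yet it contains \<open>x\<close>.\<close>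
    from R obtain x where x: "x \<in> fst Q" "x \<notin> fst R" unfolding covers_Pairs_iff by blast
    then have xS: "x \<in> S" using fst_carrier_Pairs[OF Q] by blast
    have "\<not> fst (principal x) \<subset> fst Q"
    proof
      assume "fst (principal x) \<subset> fst Q"
      then obtain R' where "covers (Pairs S r) Q R'" "fst (principal x) \<subseteq> fst R'"
        using lower_cover_above[OF finite_carrier principal_in_Pairs Q] by blast
      with uniq principal_self[OF xS] x show False by blast
    qed
    with principal_least[OF Q x(1)] have "fst (principal x) = fst Q" by blast
    then have "principal x = Q" by (rule carrier_Pairs_eqI[OF principal_in_Pairs Q])
    with xS show "Q \<in> principal ` S" by blast
  qed
qed

lemma card_Ji_Pairs: "card (Ji (Pairs S r)) = card S"
  unfolding Ji_Pairs by (rule card_image[OF inj_on_principal])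

text \<open>Reversing arrows interchanges the roles of \<open>e\<close> and \<open>m\<close>, and
  the mixed clause of two-acyclicity is invariant under this exchange.\<close>

lemma converse_system: "finite_two_acyclic_factorization_system S (r\<inverse>) (m\<inverse>) (e\<inverse>)"
proof unfold_locales
  show "r\<inverse> \<subseteq> S \<times> S" using rel_on by blast
  show "refl_on S (r\<inverse>)" using refl by simp
  show "Fact S (r\<inverse>) = (m\<inverse>, e\<inverse>)"
    by (auto simp: Fact_def e_iff m_iff)
  have "(x, z) \<in> Mult S (m\<inverse>) (e\<inverse>) \<longleftrightarrow> (x, z) \<in> r\<inverse>" for x z
    unfolding Mult_def converse_iff r_iff
    by (auto dest: e_iff[THEN iffD1] m_iff[THEN iffD1])
  then show "Mult S (m\<inverse>) (e\<inverse>) = r\<inverse>" by (intro equalityI subrelI) blast+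
  show "two_acyclic (m\<inverse>) (e\<inverse>)" using two_acyclic unfolding two_acyclic_def by blast
qed (rule finite_carrier)

end

section \<open>Duality between join- and meet-irreducibles\<close>

lemma swap_carrier_Pairs:
  "prod.swap P \<in> carrier (Pairs S (r\<inverse>)) \<longleftrightarrow> P \<in> carrier (Pairs S r)"
proof -
  have "right_perp S (r\<inverse>) = left_perp S r" "left_perp S (r\<inverse>) = right_perp S r"
    unfolding left_perp_def right_perp_def by auto
  then show ?thesis unfolding carrier_Pairs_iff fst_swap snd_swap by metis
qed

text \<open>Swapping components is an order-reversing bijection, because second components are
  ordered oppositely to first ones.\<close>

lemma covers_Pairs_converse:
  "covers (Pairs S (r\<inverse>)) (prod.swap P) (prod.swap Q) \<longleftrightarrow> covers (Pairs S r) Q P"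
proof -
  have ex_swap: "(\<exists>R\<in>carrier (Pairs S (r\<inverse>)). \<phi> R) \<longleftrightarrow>
      (\<exists>R\<in>carrier (Pairs S r). \<phi> (prod.swap R))" for \<phi>
  proof
    assume "\<exists>R\<in>carrier (Pairs S (r\<inverse>)). \<phi> R"
    then obtain R where "R \<in> carrier (Pairs S (r\<inverse>))" "\<phi> R" by blast
    then show "\<exists>R\<in>carrier (Pairs S r). \<phi> (prod.swap R)"
      using swap_carrier_Pairs[of "prod.swap R" S r]
      by (intro bexI[of _ "prod.swap R"]) simp_all
  next
    assume "\<exists>R\<in>carrier (Pairs S r). \<phi> (prod.swap R)"
    then obtain R where "R \<in> carrier (Pairs S r)" "\<phi> (prod.swap R)" by blast
    then show "\<exists>R\<in>carrier (Pairs S (r\<inverse>)). \<phi> R"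
      using swap_carrier_Pairs[of R S r] by (intro bexI[of _ "prod.swap R"]) simp_all
  qed
  show ?thesis
  proof (cases "P \<in> carrier (Pairs S r) \<and> Q \<in> carrier (Pairs S r)")
    case True
    have "(\<exists>R\<in>carrier (Pairs S r). snd Q \<subset> snd R \<and> snd R \<subset> snd P) \<longleftrightarrow>
        (\<exists>R\<in>carrier (Pairs S r). fst P \<subset> fst R \<and> fst R \<subset> fst Q)"
      by (rule bex_cong[OF HOL.refl])
        (simp only: Pairs_snd_antimono[of P S r] Pairs_snd_antimono[of _ S r Q] True conj_commute)
    with True show ?thesis
      unfolding covers_Pairs_iff ex_swap swap_carrier_Pairs fst_swap
      by (simp only: Pairs_snd_antimono[of P S r Q] simp_thms)
  next
    case False
    then show ?thesis unfolding covers_Pairs_iff swap_carrier_Pairs by blast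
  qed
qed

text \<open>Order reversal turns upper covers into lower covers, so counting join-irreducibles of
  the converse system counts meet-irreducibles here.\<close>

lemma Mi_Pairs_converse:
  fixes r :: "'a rel"
  shows "Mi (Pairs S r) = prod.swap ` Ji (Pairs S (r\<inverse>))"
proof -
  have Mi_iff: "P \<in> Mi (Pairs S r) \<longleftrightarrow> prod.swap P \<in> Ji (Pairs S (r\<inverse>))" for P
  proof -
    have ex1_swap: "(\<exists>!Q. \<phi> Q) \<longleftrightarrow> (\<exists>!Q. \<phi> (prod.swap Q))" for \<phi> :: "'a set \<times> 'a set \<Rightarrow> bool"
      by (metis swap_swap)
    have conv: "covers (Pairs S (r\<inverse>)) (prod.swap P) = (\<lambda>Q. covers (Pairs S r) (prod.swap Q) P)"
      using covers_Pairs_converse[of S r P "prod.swap Q" for Q] by (simp add: fun_eq_iff)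
    have "(\<exists>!Q. covers (Pairs S r) Q P) \<longleftrightarrow>
        (\<exists>!Q. covers (Pairs S (r\<inverse>)) (prod.swap P) Q)"
      unfolding conv by (rule ex1_swap)
    then show ?thesis unfolding Mi_def Ji_def using swap_carrier_Pairs[of P S r] by simp
  qed
  show ?thesis
  proof (intro equalityI subsetI)
    fix P assume "P \<in> Mi (Pairs S r)"
    then have "prod.swap P \<in> Ji (Pairs S (r\<inverse>))" by (simp add: Mi_iff)
    then show "P \<in> prod.swap ` Ji (Pairs S (r\<inverse>))"
      by (intro image_eqI[of _ _ "prod.swap P"]) simp_all
  qed (auto simp: Mi_iff)
qed

lemma (in finite_two_acyclic_factorization_system) card_Mi_Pairs:
  "card (Mi (Pairs S r)) = card S"
proof -
  interpret conv: finite_two_acyclic_factorization_system S "r\<inverse>" "m\<inverse>" "e\<inverse>"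
    by (rule converse_system)
  show ?thesis
    unfolding Mi_Pairs_converse using conv.card_Ji_Pairs by (simp add: card_image)
qed

section \<open>Chains of maximal length\<close>

definition up_closed :: "'a rel \<Rightarrow> 'a set \<Rightarrow> bool" where
  "up_closed r U \<longleftrightarrow> (\<forall>x\<in>U. \<forall>y. (x, y) \<in> r \<longrightarrow> y \<in> U)"

text \<open>No arrow leaves \<open>U\<close>, so \<open>U\<close> is orthogonal to its complement;
  loops keep points of \<open>U\<close> out of its right perp and points of the complement out of
  its left perp.\<close>

lemma up_closed_in_Pairs:
  assumes "refl_on S r" "U \<subseteq> S" "up_closed r U"
  shows "(U, S - U) \<in> carrier (Pairs S r)"
  using assms unfolding carrier_Pairs_iff left_perp_def right_perp_def up_closed_def
  by (auto dest: refl_onD)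

text \<open>Induction on \<open>card U\<close>: deleting a source leaves an up-closed set with one
  point fewer, whose chain is completed by \<open>U\<close> on top.\<close>

lemma acyclic_up_closed_chain:
  assumes "finite U" "acyclic (r - Id)" "up_closed r U"
  shows "\<exists>X. (\<forall>i\<le>card U. X i \<subseteq> U \<and> up_closed r (X i)) \<and> (\<forall>i<card U. X i \<subset> X (Suc i))"
  using assms(1,3)
proof (induction "card U" arbitrary: U)
  case 0
  then show ?case by (intro exI[of _ "\<lambda>_. U"]) simp
next
  case (Suc n)
  let ?q = "(r - Id) \<inter> U \<times> U"
  \<comment> \<open>Acyclicity on a finite set gives a minimal \<open>s\<close>: within
    \<open>U\<close>, only \<open>s\<close> itself can point to \<open>s\<close>.\<close>
  have "wf ?q"
    using Suc.prems(1) assms(2) by (intro finite_acyclic_wf) (auto intro: acyclic_subset)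
  moreover have "U \<noteq> {}" using Suc.hyps(2) by auto
  ultimately obtain s where s: "s \<in> U" "\<And>y. (y, s) \<in> ?q \<Longrightarrow> y \<notin> U"
    by (metis wf_eq_minimal ex_in_conv)
  let ?V = "U - {s}"
  have card: "n = card ?V" using Suc s(1) by simp
  have "up_closed r ?V" using s Suc.prems(2) unfolding up_closed_def by blast
  from Suc.hyps(1)[OF card _ this] Suc.prems(1) obtain X
    where X: "\<forall>i\<le>n. X i \<subseteq> ?V \<and> up_closed r (X i)" "\<forall>i<n. X i \<subset> X (Suc i)"
    unfolding card[symmetric] by blast
  \<comment> \<open>\<open>X\<close> is controlled only up to index \<open>n\<close>; its value at
    \<open>Suc n\<close>, the cardinality of \<open>U\<close>, is overridden.\<close>
  let ?X = "X(Suc n := U)"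
  have "X i \<subseteq> U \<and> up_closed r (X i)" if "i \<le> n" for i
    using X(1) that by blast
  then have "?X i \<subseteq> U \<and> up_closed r (?X i)" if "i \<le> Suc n" for i
    using Suc.prems(2) that by (cases "i = Suc n") simp_all
  moreover have "?X i \<subset> ?X (Suc i)" if "i < Suc n" for i
  proof (cases "i = n")
    case True
    then show ?thesis using X(1) s(1) by auto
  next
    case False
    then show ?thesis using that X(2) by simp
  qed
  ultimately show ?case unfolding Suc.hyps(2)[symmetric] by blast
qed

lemma chain_if_acyclic:
  assumes "finite S" "r \<subseteq> S \<times> S" "refl_on S r" "acyclic (r - Id)"
  shows "has_chain_of_length (Pairs S r) (card S)"
proof -
  have "up_closed r S" using assms(2) unfolding up_closed_def by blast
  from acyclic_up_closed_chain[OF assms(1,4) this] obtain X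
    where X: "\<forall>i\<le>card S. X i \<subseteq> S \<and> up_closed r (X i)" "\<forall>i<card S. X i \<subset> X (Suc i)"
    by blast
  have mem: "(X i, S - X i) \<in> carrier (Pairs S r)" if "i \<le> card S" for i
    using X(1) that assms(3) by (intro up_closed_in_Pairs) simp_all
  show ?thesis
    unfolding has_chain_of_length_def
    by (intro exI[of _ "\<lambda>i. (X i, S - X i)"]) (simp add: mem X(2) Pairs_less)
qed

section \<open>Acyclicity from long chains\<close>

lemma card_strict_chain:
  fixes X :: "nat \<Rightarrow> 'a set"
  assumes "finite S" "\<And>i. i \<le> n \<Longrightarrow> X i \<subseteq> S" "\<And>i. i < n \<Longrightarrow> X i \<subset> X (Suc i)" "i \<le> n"
  shows "i + card (X 0) \<le> card (X i)"
  using assms(4)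
proof (induction i)
  case (Suc i)
  then have "card (X i) < card (X (Suc i))"
    using assms by (intro psubset_card_mono) (auto intro: finite_subset)
  with Suc show ?case by simp
qed simp

lemma acyclic_if_chain:
  assumes fin: "finite S" and rS: "r \<subseteq> S \<times> S" and refl: "refl_on S r"
    and chain: "has_chain_of_length (Pairs S r) (card S)"
  shows "acyclic (r - Id)"
proof -
  let ?n = "card S"
  obtain P where P: "\<And>i. i \<le> ?n \<Longrightarrow> P i \<in> carrier (Pairs S r)"
      "\<And>i. i < ?n \<Longrightarrow> P i \<sqsubset>\<^bsub>Pairs S r\<^esub> P (Suc i)"
    using chain unfolding has_chain_of_length_def by blast
  have X_less: "fst (P i) \<subset> fst (P (Suc i))" if "i < ?n" for i
    using P that Pairs_less[of "P i" S r "P (Suc i)"] by simp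
  have Y_less: "snd (P (Suc i)) \<subset> snd (P i)" if "i < ?n" for i
    using X_less[OF that] Pairs_snd_antimono[of "P i" S r "P (Suc i)"] P(1) that by simp
  have X_sub: "fst (P i) \<subseteq> S" and Y_sub: "snd (P i) \<subseteq> S" if "i \<le> ?n" for i
    using P(1)[OF that] by (auto dest: fst_carrier_Pairs snd_carrier_Pairs)
  have X_ge: "i \<le> card (fst (P i))" if "i \<le> ?n" for i
    using card_strict_chain[OF fin, of ?n "\<lambda>i. fst (P i)" i] X_sub X_less that by simp
  \<comment> \<open>Second components shrink, so their chain is read from \<open>?n\<close>
    downwards; \<open>P i\<close> then sits at position \<open>?n - i\<close>.\<close>
  have Y_ge: "?n - i \<le> card (snd (P i))" if "i \<le> ?n" for i
  proof -
    have "snd (P (?n - j)) \<subset> snd (P (?n - Suc j))" if "j < ?n" for j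
      using Y_less[of "?n - Suc j"] that by (simp add: Suc_diff_Suc)
    then show ?thesis
      using card_strict_chain[OF fin, of ?n "\<lambda>j. snd (P (?n - j))" "?n - i"] Y_sub that by simp
  qed
  have disj: "fst (P i) \<inter> snd (P i) = {}" if "i \<le> ?n" for i
    using Pairs_orthogonal[OF P(1)[OF that]] X_sub[OF that] refl_onD[OF refl] by blast
  have card_Un: "card (fst (P i)) + card (snd (P i)) = card (fst (P i) \<union> snd (P i))"
    if "i \<le> ?n" for i
    using card_Un_disjoint[OF finite_subset[OF X_sub fin] finite_subset[OF Y_sub fin] disj] that
    by metis
  have Un_le: "card (fst (P i) \<union> snd (P i)) \<le> ?n" if "i \<le> ?n" for i
    using X_sub[OF that] Y_sub[OF that] by (intro card_mono[OF fin]) simp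
  \<comment> \<open>The lower bounds \<open>i\<close> and \<open>?n - i\<close> already add up to
    \<open>?n\<close>, while disjointness caps the sum of the cardinalities at \<open>?n\<close>;
    hence equality throughout.\<close>
  have X_card: "card (fst (P i)) = i" if "i \<le> ?n" for i
    using X_ge[OF that] Y_ge[OF that] card_Un[OF that] Un_le[OF that] that by linarith
  have Y_eq: "snd (P i) = S - fst (P i)" if "i \<le> ?n" for i
  proof -
    have "card (fst (P i) \<union> snd (P i)) = ?n"
      using X_ge[OF that] Y_ge[OF that] card_Un[OF that] Un_le[OF that] that by linarith
    then have "fst (P i) \<union> snd (P i) = S"
      using X_sub[OF that] Y_sub[OF that] fin by (intro card_subset_eq) auto
    with disj[OF that] show ?thesis by blast
  qed
  have up: "y \<in> fst (P i)" if "i \<le> ?n" "x \<in> fst (P i)" "(x, y) \<in> r" for i x y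
    using Pairs_orthogonal[OF P(1)[OF that(1)] that(2)] Y_eq[OF that(1)] that(3) rS by blast
  \<comment> \<open>The stage at which \<open>x\<close> enters the chain; every point of
    \<open>S\<close> has one, since the chain ends at \<open>S\<close>.\<close>
  define rank where "rank x = (LEAST i. x \<in> fst (P i))" for x
  have top: "fst (P ?n) = S"
    using X_card[of ?n] X_sub[of ?n] fin by (intro card_subset_eq) auto
  have rank: "rank x \<le> ?n" "x \<in> fst (P (rank x))" if "x \<in> S" for x
    unfolding rank_def using that top by (auto intro: Least_le LeastI)
  \<comment> \<open>The head of an arrow enters no later than its tail by up-closure, and distinct
    points cannot enter together because each stage adds exactly one.\<close>
  have rank_less: "rank y < rank x" if xy: "(x, y) \<in> r" "x \<noteq> y" for x y
  proof -
    have x: "x \<in> S" and y: "y \<in> S" using xy rS by auto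
    have "rank y \<le> rank x"
      using up[OF rank(1)[OF x] rank(2)[OF x] xy(1)] unfolding rank_def by (rule Least_le)
    moreover have "rank y \<noteq> rank x"
    proof
      assume eq: "rank y = rank x"
      \<comment> \<open>Starting from the empty set, the common rank must be a successor, so a
        preceding stage exists.\<close>
      have "fst (P 0) = {}" using X_card[of 0] X_sub[of 0] fin by (simp add: finite_subset)
      with rank(2)[OF x] obtain k where k: "rank x = Suc k" by (cases "rank x") auto
      have "x \<notin> fst (P k)" "y \<notin> fst (P k)"
        using eq k not_less_Least unfolding rank_def by (metis lessI)+
      moreover have "k < ?n" using rank(1)[OF x] k by simp
      moreover have "{x, y} \<subseteq> fst (P (Suc k))" using rank(2)[OF x] rank(2)[OF y] eq k by simp
      ultimately have "{x, y} \<subseteq> fst (P (Suc k)) - fst (P k)" by blast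
      moreover have "card (fst (P (Suc k)) - fst (P k)) = 1"
      proof -
        have "finite (fst (P k))" using X_sub[of k] fin \<open>k < ?n\<close> by (simp add: finite_subset)
        then show ?thesis
          using X_less[OF \<open>k < ?n\<close>] X_card[of k] X_card[of "Suc k"] \<open>k < ?n\<close>
          by (simp add: card_Diff_subset psubset_imp_subset)
      qed
      ultimately show False using xy(2) by (metis card_1_singletonE insert_subset singletonD)
    qed
    ultimately show ?thesis by simp
  qed
  \<comment> \<open>Ranks fall along arrows, so it is the converse that embeds in
    \<open>measure rank\<close>; acyclicity transfers because cycles can be reversed.\<close>
  have "(r - Id)\<inverse> \<subseteq> measure rank"
  proof (intro subrelI)
    fix y x assume "(y, x) \<in> (r - Id)\<inverse>"
    then show "(y, x) \<in> measure rank" using rank_less[of x y] by simp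
  qed
  then have "wf ((r - Id)\<inverse>)" by (rule wf_subset[OF wf_measure])
  then show ?thesis using wf_acyclic acyclic_converse by blast
qed

theorem proposition7p14:
  fixes S :: "'a set" and r e m :: "'a rel"
  assumes "finite_factorization_system S r e m"
    and "two_acyclic e m"
  shows "extremal (Pairs S r) \<longleftrightarrow> acyclic_reflexive S r"
proof -
  interpret finite_two_acyclic_factorization_system S r e m
    using assms
    by (simp add: finite_two_acyclic_factorization_system_def
        finite_two_acyclic_factorization_system_axioms_def)
  interpret L: complete_lattice "Pairs S r" by (rule Pairs_complete_lattice)
  \<comment> \<open>Both irreducible counts equal \<open>card S\<close>, and the lattice and
    finiteness clauses hold; only the chain condition remains.\<close>
  have "extremal (Pairs S r) \<longleftrightarrow> has_chain_of_length (Pairs S r) (card S)"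
    unfolding extremal_def card_Ji_Pairs card_Mi_Pairs
    using L.lattice_axioms finite_carrier_Pairs[OF finite_carrier] by simp
  then show ?thesis
    unfolding acyclic_reflexive_def
    using acyclic_if_chain[OF finite_carrier rel_on refl]
      chain_if_acyclic[OF finite_carrier rel_on refl] rel_on refl by blast
qed

end
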